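(* Let $ABCD$ be a convex equidiagonal kite with $AB=BC$ and $AD=CD$ which is not a square, and let $E$ be the Steiner point of $ABCD$. Let $F$, $G$, $H$, and $I$ be the $X_{642}$ points of $\triangle EAB$, $\triangle EBC$, $\triangle ECD$, and $\triangle EDA$, respectively. Then $FGHI$ is a square homothetic to the Varignon parallelogram of $ABCD$ and $$[ABCD]=8[FGHI].$$ The two squares ($FGHI$ and the Varignon parallelogram of $ABCD$) have the same diagonal point.
   Context: A quadrilateral is equidiagonal if its diagonals have equal length. A midray circle of a quadrilateral is the circle through the midpoints of the line segments joining one vertex of the quadrilateral to the other three vertices; the Steiner point of a quadrilateral is the common point of its four midray circles. The $X_{642}$ point of a triangle is the circumcenter of the triangle formed by the centers of the squares erected inwards on the three sides of the triangle. The Varignon parallelogram of $ABCD$ is the parallelogram whose vertices are the midpoints of the sides $AB$, $BC$, $CD$, $DA$. The diagonal point of a quadrilateral is the intersection of its diagonals. $[XYZW]$ denotes the area of the quadrilateral $XYZW$. *)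

theory Defs
  imports "HOL-Analysis.Analysis"
begin

text \<open>Quadrilaterals in the Euclidean plane are given by their four vertices in cyclic order.
  Points that the text introduces with a definite article are rendered by definite descriptions,
  so nothing can be derived about them before existence and uniqueness have been proved.\<close>

type_synonym point = "real^2"

definition convex_quadrilateral :: "point \<Rightarrow> point \<Rightarrow> point \<Rightarrow> point \<Rightarrow> bool" where
  "convex_quadrilateral A B C D \<longleftrightarrow>
     \<not> collinear {A, B, C} \<and> \<not> collinear {B, C, D} \<and>
     \<not> collinear {C, D, A} \<and> \<not> collinear {D, A, B} \<and>
     open_segment A C \<inter> open_segment B D \<noteq> {}"

definition equidiagonal :: "point \<Rightarrow> point \<Rightarrow> point \<Rightarrow> point \<Rightarrow> bool" where
  "equidiagonal A B C D \<longleftrightarrow> dist A C = dist B D"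

definition square :: "point \<Rightarrow> point \<Rightarrow> point \<Rightarrow> point \<Rightarrow> bool" where
  "square A B C D \<longleftrightarrow>
     A \<noteq> B \<and>
     dist A B = dist B C \<and> dist B C = dist C D \<and> dist C D = dist D A \<and>
     orthogonal (A - B) (C - B) \<and> orthogonal (B - C) (D - C) \<and>
     orthogonal (C - D) (A - D) \<and> orthogonal (D - A) (B - A)"

definition diagonal_point :: "point \<Rightarrow> point \<Rightarrow> point \<Rightarrow> point \<Rightarrow> point" where
  "diagonal_point A B C D = (THE P. closed_segment A C \<inter> closed_segment B D = {P})"

text \<open>Only meaningful for convex quadrilaterals, whose region is the convex hull of the vertices.\<close>

definition quad_area :: "point \<Rightarrow> point \<Rightarrow> point \<Rightarrow> point \<Rightarrow> real" where
  "quad_area A B C D = measure lebesgue (convex hull {A, B, C, D})"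

definition circumcenter :: "point \<Rightarrow> point \<Rightarrow> point \<Rightarrow> point" where
  "circumcenter X Y Z = (THE P. dist P X = dist P Y \<and> dist P Y = dist P Z)"

definition circle_through :: "point \<Rightarrow> point \<Rightarrow> point \<Rightarrow> point set" where
  "circle_through X Y Z = sphere (circumcenter X Y Z) (dist (circumcenter X Y Z) X)"

text \<open>The midray circle belonging to the vertex given as first argument.\<close>

definition midray_circle :: "point \<Rightarrow> point \<Rightarrow> point \<Rightarrow> point \<Rightarrow> point set" where
  "midray_circle A B C D = circle_through (midpoint A B) (midpoint A C) (midpoint A D)"

definition steiner_point :: "point \<Rightarrow> point \<Rightarrow> point \<Rightarrow> point \<Rightarrow> point" where
  "steiner_point A B C D =
     (THE P. P \<in> midray_circle A B C D \<inter> midray_circle B C D A \<inter>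
                 midray_circle C D A B \<inter> midray_circle D A B C)"

definition same_side :: "point \<Rightarrow> point \<Rightarrow> point \<Rightarrow> point \<Rightarrow> bool" where
  "same_side X Y P Q \<longleftrightarrow> closed_segment P Q \<inter> affine hull {X, Y} = {}"

text \<open>The center of the square \<open>X Y P Q\<close> erected on the side \<open>X Y\<close> of the triangle \<open>X Y Z\<close>,
  towards \<open>Z\<close>.\<close>

definition inward_square_center :: "point \<Rightarrow> point \<Rightarrow> point \<Rightarrow> point" where
  "inward_square_center X Y Z =
     (THE M. \<exists>P Q. square X Y P Q \<and> same_side X Y P Z \<and> M = midpoint X P)"

definition X642 :: "point \<Rightarrow> point \<Rightarrow> point \<Rightarrow> point" where
  "X642 X Y Z = circumcenter (inward_square_center Y Z X)
                             (inward_square_center Z X Y)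
                             (inward_square_center X Y Z)"

text \<open>Homothetic as labelled quadrilaterals: vertices correspond in the listed order.
  The ratio \<open>k\<close> may be negative.\<close>

definition homothetic_quads ::
    "point \<Rightarrow> point \<Rightarrow> point \<Rightarrow> point \<Rightarrow> point \<Rightarrow> point \<Rightarrow> point \<Rightarrow> point \<Rightarrow> bool" where
  "homothetic_quads A B C D A' B' C' D' \<longleftrightarrow>
     (\<exists>Z (k::real). k \<noteq> 0 \<and>
        A' = Z + k *\<^sub>R (A - Z) \<and> B' = Z + k *\<^sub>R (B - Z) \<and>
        C' = Z + k *\<^sub>R (C - Z) \<and> D' = Z + k *\<^sub>R (D - Z))"

end

theory Submission
  imports Defs
begin

text \<open>The diagonal \<open>B D\<close> of the kite is its axis of symmetry, so it bisects \<open>A C\<close> at a right angle.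
  Take the midpoint of \<open>A C\<close> as origin, half of \<open>C A\<close> as the first basis vector \<open>u\<close> and a vector
  \<open>v\<close> along the axis with the length of \<open>u\<close> as the second. Since the diagonals are equal,
  \<open>A = (1, 0)\<close>, \<open>B = (0, e + 1)\<close>, \<open>C = (-1, 0)\<close>, \<open>D = (0, e - 1)\<close>; convexity means \<open>-1 < e < 1\<close>,
  and \<open>e = 0\<close> is the square (\<open>kite_frame\<close>).

  The midray circles of \<open>B\<close> and \<open>D\<close> pass through the midpoint \<open>(0, e)\<close> of \<open>B D\<close> by definition. Those
  of \<open>A\<close> and \<open>C\<close> are mirror images in the axis, which they meet at \<open>(0, 0)\<close> and, by symmetry in
  the horizontal line at height \<open>e / 2\<close>, at \<open>(0, e)\<close>. Hence the Steiner point is \<open>E = (0, e)\<close>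
  (\<open>steiner_point_kite\<close>).

  Now \<open>E B\<close> and \<open>E D\<close> have length 1 like the half diagonals, and an explicit computation of the
  centers of the inward squares gives \<open>(\<plusminus>1/4, e/2 \<plusminus> 1/4)\<close> for the four \<open>X\<^sub>6\<^sub>4\<^sub>2\<close> points
  (\<open>X642_kite\<close>). The three centers span a triangle of area \<open>\<bar>e (e + 1)\<bar> / 4\<close> or
  \<open>\<bar>e (e - 1)\<bar> / 4\<close>; so they are collinear for a square, and only then. The midpoints of the sides
  of the kite are \<open>(\<plusminus>1/2, e/2 \<plusminus> 1/2)\<close>. Thus both quadrilaterals are squares about \<open>(0, e/2)\<close>, one
  being the image of the other under the homothety of ratio 2. With the square on \<open>u\<close> as unit of
  area, the kite has half the product of its diagonals, \<open>2\<close>, and \<open>F G H I\<close> has \<open>1/4\<close>.\<close>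

section \<open>The area of a quadrilateral from its diagonals\<close>

definition cross2 :: "point \<Rightarrow> point \<Rightarrow> real" where
  "cross2 p q = p$1 * q$2 - p$2 * q$1"

lemma cross2_simps:
  "cross2 (p + q) r = cross2 p r + cross2 q r"
  "cross2 p (q + r) = cross2 p q + cross2 p r"
  "cross2 (k *\<^sub>R p) q = k * cross2 p q"
  "cross2 p (k *\<^sub>R q) = k * cross2 p q"
  "cross2 p p = 0"
  by (simp_all add: cross2_def algebra_simps)

lemma cross2_skew: "cross2 p q = - cross2 q p"
  by (simp add: cross2_def)

lemma measure_triangle:
  "measure lebesgue (convex hull {X, Y, Z :: point}) = \<bar>cross2 (Y - X) (Z - X)\<bar> / 2"
proof -
  have "measure lebesgue (convex hull {X, Y, Z}) = measure lborel (convex hull {X, Y, Z})"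
    by (simp add: measure_completion borel_closed compact_imp_closed finite_imp_compact_convex_hull)
  then show ?thesis
    by (simp add: content_triangle cross2_def mult.commute abs_minus_commute)
qed

lemma negligible_line:
  assumes "w \<noteq> (0::point)"
  shows "negligible {p. cross2 w (p - z) = 0}"
proof -
  define n :: point where "n = (\<chi> i. if i = 1 then - (w$2) else w$1)"
  have n: "cross2 w q = n \<bullet> q" for q
    by (simp add: cross2_def n_def inner_vec_def sum_2)
  have "n \<noteq> 0"
    using assms by (auto simp: n_def vec_eq_iff forall_2)
  then have "negligible {p. n \<bullet> p = n \<bullet> z}"
    by (simp add: negligible_hyperplane)
  then show ?thesis
    by (simp add: n inner_diff_right)
qed

text \<open>A convex combination of four points can be made to avoid \<open>B\<close> or \<open>D\<close>: subtract a multiple of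
  the affine relation that expresses the crossing point both on \<open>A C\<close> and on \<open>B D\<close>.\<close>

lemma convex_hull_split_diagonal:
  fixes A B C D :: "'a::real_vector"
  assumes "X \<in> closed_segment A C" "X \<in> open_segment B D"
  shows "convex hull {A, B, C, D} = convex hull {A, C, B} \<union> convex hull {A, C, D}"
proof (rule subset_antisym)
  obtain s where s: "0 \<le> s" "s \<le> 1" "X = (1 - s) *\<^sub>R A + s *\<^sub>R C"
    using assms(1) by (auto simp: in_segment)
  obtain t where t: "0 < t" "t < 1" "X = (1 - t) *\<^sub>R B + t *\<^sub>R D"
    using assms(2) by (auto simp: in_segment)
  have rel: "(1 - t) *\<^sub>R B + t *\<^sub>R D = (1 - s) *\<^sub>R A + s *\<^sub>R C"
    using s(3) t(3) by simp
  show "convex hull {A, B, C, D} \<subseteq> convex hull {A, C, B} \<union> convex hull {A, C, D}"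
  proof
    fix p assume "p \<in> convex hull {A, B, C, D}"
    then have "p \<in> convex hull (insert D {A, C, B})"
      by (simp add: insert_commute)
    then obtain d l q where p: "0 \<le> d" "0 \<le> l" "d + l = 1" "q \<in> convex hull {A, C, B}"
        "p = d *\<^sub>R D + l *\<^sub>R q"
      unfolding convex_hull_insert[OF insert_not_empty] by blast
    then obtain a' c' b' where q: "0 \<le> a'" "0 \<le> b'" "0 \<le> c'" "a' + c' + b' = 1"
        "q = a' *\<^sub>R A + c' *\<^sub>R C + b' *\<^sub>R B"
      unfolding convex_hull_3 by blast
    define a b c where "a = l * a'" and "b = l * b'" and "c = l * c'"
    have nn: "0 \<le> a" "0 \<le> b" "0 \<le> c"
      using p q by (auto simp: a_def b_def c_def)
    have "a + b + c = l * (a' + c' + b')"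
      by (simp add: a_def b_def c_def algebra_simps)
    then have sum1: "a + b + c + d = 1"
      using p(3) q(4) by simp
    have p': "p = a *\<^sub>R A + b *\<^sub>R B + c *\<^sub>R C + d *\<^sub>R D"
      by (simp add: p(5) q(5) a_def b_def c_def algebra_simps)
    show "p \<in> convex hull {A, C, B} \<union> convex hull {A, C, D}"
    proof (cases "d * (1 - t) \<le> b * t")
      case True
      define m where "m = d / t"
      have m: "0 \<le> m" "m * t = d" using t p(1) by (auto simp: m_def)
      have "m * (1 - t) \<le> b"
        using True t by (simp add: m_def field_simps)
      moreover have "p = (a + m * (1 - s)) *\<^sub>R A + (c + m * s) *\<^sub>R C + (b - m * (1 - t)) *\<^sub>R B"
      proof -
        have "p = a *\<^sub>R A + c *\<^sub>R C + (b - m * (1 - t)) *\<^sub>R B + m *\<^sub>R ((1 - t) *\<^sub>R B + t *\<^sub>R D)"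
          by (simp add: p' m(2)[symmetric] algebra_simps)
        then show ?thesis
          unfolding rel by (simp add: algebra_simps)
      qed
      moreover have "(a + m * (1 - s)) + (c + m * s) + (b - m * (1 - t)) = 1"
        using sum1 m(2) by (simp add: algebra_simps)
      ultimately have "p \<in> convex hull {A, C, B}"
        unfolding convex_hull_3 using nn s m(1)
        by (intro CollectI exI[of _ "a + m * (1 - s)"] exI[of _ "c + m * s"]
            exI[of _ "b - m * (1 - t)"]) auto
      then show ?thesis ..
    next
      case False
      define m where "m = b / (1 - t)"
      have m: "0 \<le> m" "m * (1 - t) = b" using t nn by (auto simp: m_def)
      have "m * t \<le> d"
        using False t by (simp add: m_def field_simps)
      moreover have "p = (a + m * (1 - s)) *\<^sub>R A + (c + m * s) *\<^sub>R C + (d - m * t) *\<^sub>R D"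
      proof -
        have "p = a *\<^sub>R A + c *\<^sub>R C + (d - m * t) *\<^sub>R D + m *\<^sub>R ((1 - t) *\<^sub>R B + t *\<^sub>R D)"
          by (simp add: p' m(2)[symmetric] algebra_simps)
        then show ?thesis
          unfolding rel by (simp add: algebra_simps)
      qed
      moreover have "(a + m * (1 - s)) + (c + m * s) + (d - m * t) = 1"
        using sum1 m(2) by (simp add: algebra_simps)
      ultimately have "p \<in> convex hull {A, C, D}"
        unfolding convex_hull_3 using nn s m(1)
        by (intro CollectI exI[of _ "a + m * (1 - s)"] exI[of _ "c + m * s"]
            exI[of _ "d - m * t"]) auto
      then show ?thesis ..
    qed
  qed
  show "convex hull {A, C, B} \<union> convex hull {A, C, D} \<subseteq> convex hull {A, B, C, D}"
    by (intro Un_least hull_mono) auto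
qed

text \<open>A triangle lies on one side of the line through any of its edges; the factor \<open>k\<close> carries the
  sign that tells which side.\<close>

lemma cross2_convex_hull_nonneg:
  assumes "p \<in> convex hull {A, C, B}" "0 \<le> k * cross2 (C - A) (B - A)"
  shows "0 \<le> k * cross2 (C - A) (p - A)"
proof -
  obtain x y where xy: "0 \<le> y" "p = A + x *\<^sub>R (C - A) + y *\<^sub>R (B - A)"
    using assms(1) unfolding convex_hull_3_alt by blast
  have "cross2 (C - A) (p - A) = cross2 (C - A) (x *\<^sub>R (C - A) + y *\<^sub>R (B - A))"
    by (simp add: xy(2))
  also have "\<dots> = y * cross2 (C - A) (B - A)"
    by (simp add: cross2_simps(2-5))
  finally show ?thesis
    using mult_nonneg_nonneg[OF xy(1) assms(2)] by (simp add: mult.left_commute)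
qed

text \<open>The diagonal \<open>A C\<close> cuts the quadrilateral into two triangles on opposite sides of the line
  \<open>A C\<close>, so they overlap in a null set only, and their signed areas add up to a cross product that
  depends on the two diagonals alone.\<close>

lemma quad_area_diagonals:
  assumes "A \<noteq> C" "X \<in> closed_segment A C" "X \<in> open_segment B D"
  shows "quad_area A B C D = \<bar>cross2 (C - A) (D - B)\<bar> / 2"
proof -
  define f where "f = (\<lambda>p. cross2 (C - A) (p - A))"
  obtain s where s: "0 \<le> s" "s \<le> 1" "X = (1 - s) *\<^sub>R A + s *\<^sub>R C"
    using assms(2) by (auto simp: in_segment)
  obtain t where t: "0 < t" "t < 1" "X = (1 - t) *\<^sub>R B + t *\<^sub>R D"
    using assms(3) by (auto simp: in_segment)
  have "X - A = s *\<^sub>R (C - A)"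
    by (simp add: s(3) algebra_simps)
  then have "f X = 0"
    by (simp add: f_def cross2_simps(4,5))
  moreover have "f X = (1 - t) * f B + t * f D"
    unfolding f_def t(3) by (simp add: cross2_def algebra_simps)
  ultimately have fBD: "(1 - t) * f B = - t * f D" by simp
  \<comment> \<open>As \<open>X\<close> is strictly between \<open>B\<close> and \<open>D\<close>, these two points are not strictly on the same side
    of \<open>A C\<close>.\<close>
  obtain k :: real where k: "k \<noteq> 0" "0 \<le> k * f B" "0 \<le> - k * f D"
  proof (cases "0 \<le> f B")
    case True
    then have "0 \<le> (1 - t) * f B" using t by simp
    with fBD have "t * f D \<le> 0" by simp
    with t have "f D \<le> 0" by (simp add: mult_le_0_iff)
    with True that[of 1] show thesis by simp
  next
    case False
    then have "(1 - t) * f B < 0" using t by (simp add: mult_less_0_iff)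
    with fBD have "0 < t * f D" by simp
    with t have "0 < f D" by (simp add: zero_less_mult_iff)
    with False that[of "-1"] show thesis by simp
  qed
  have "convex hull {A, C, B} \<inter> convex hull {A, C, D} \<subseteq> {p. f p = 0}"
  proof
    fix p assume "p \<in> convex hull {A, C, B} \<inter> convex hull {A, C, D}"
    then have "0 \<le> k * f p" "0 \<le> - k * f p"
      using cross2_convex_hull_nonneg[of p A C B k] cross2_convex_hull_nonneg[of p A C D "- k"] k
      by (auto simp: f_def)
    then have "k * f p = 0" by linarith
    with k(1) show "p \<in> {p. f p = 0}" by simp
  qed
  then have "negligible (convex hull {A, C, B} \<inter> convex hull {A, C, D})"
    using negligible_line[of "C - A" A] assms(1) negligible_subset unfolding f_def by auto
  then have null: "measure lebesgue (convex hull {A, C, B} \<inter> convex hull {A, C, D}) = 0"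
    by (rule negligible_imp_measure0)
  have lm: "convex hull {A, C, Y} \<in> lmeasurable" for Y
    by (intro lmeasurable_compact finite_imp_compact_convex_hull) simp
  have "quad_area A B C D = \<bar>f B\<bar> / 2 + \<bar>f D\<bar> / 2"
    unfolding quad_area_def convex_hull_split_diagonal[OF assms(2,3)] measure_Un3[OF lm lm] null
    by (simp add: measure_triangle f_def)
  also have "\<dots> = \<bar>f D - f B\<bar> / 2"
    using k by (cases "k > 0") (auto simp: zero_le_mult_iff mult_le_0_iff)
  also have "f D - f B = cross2 (C - A) (D - B)"
    by (simp add: f_def cross2_def algebra_simps)
  finally show ?thesis .
qed

section \<open>Coordinates in a square frame\<close>

text \<open>Orthogonal vectors of equal length turn distances, right angles and signed areas into the
  usual coordinate expressions, up to a constant factor, without fixing a scale or an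
  orientation of the plane. In particular a quarter turn is \<open>(x, y) \<mapsto> (-y, x)\<close>.\<close>

locale square_frame =
  fixes c u v :: point
  assumes orth: "u \<bullet> v = 0" and norms: "norm v = norm u" and nonzero: "u \<noteq> 0"
begin

definition pt :: "real \<Rightarrow> real \<Rightarrow> point" where
  "pt x y = c + x *\<^sub>R u + y *\<^sub>R v"

lemma v_nonzero: "v \<noteq> 0"
  using norms nonzero by auto

lemma vv: "v \<bullet> v = u \<bullet> u"
  using norms by (simp add: dot_square_norm)

lemma pt_diff: "pt a b - pt x y = (a - x) *\<^sub>R u + (b - y) *\<^sub>R v"
  by (simp add: pt_def algebra_simps)

lemma inner_frame:
  "(a *\<^sub>R u + b *\<^sub>R v) \<bullet> (x *\<^sub>R u + y *\<^sub>R v) = (a * x + b * y) * (u \<bullet> u)"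
  using orth by (simp add: inner_add vv inner_commute[of v u] algebra_simps)

lemma dist_pt: "dist (pt a b) (pt x y) = sqrt (((a - x)\<^sup>2 + (b - y)\<^sup>2) * (u \<bullet> u))"
  unfolding dist_norm pt_diff norm_eq_sqrt_inner inner_frame by (simp add: power2_eq_square)

lemma dist_pt_eq_iff:
  "dist (pt a b) (pt x y) = dist (pt a' b') (pt x' y')
     \<longleftrightarrow> (a - x)\<^sup>2 + (b - y)\<^sup>2 = (a' - x')\<^sup>2 + (b' - y')\<^sup>2"
  using nonzero by (simp add: dist_pt)

lemma orthogonal_pt_iff:
  "orthogonal (pt a b - pt x y) (pt a' b' - pt x' y')
     \<longleftrightarrow> (a - x) * (a' - x') + (b - y) * (b' - y') = 0"
  using nonzero by (simp add: orthogonal_def pt_diff inner_frame)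

lemma pt_eq_iff: "pt a b = pt x y \<longleftrightarrow> a = x \<and> b = y"
proof -
  have "pt a b = pt x y \<longleftrightarrow> dist (pt a b) (pt x y) = 0" by simp
  also have "\<dots> \<longleftrightarrow> a = x \<and> b = y"
    using nonzero by (simp add: dist_pt sum_power2_eq_zero_iff)
  finally show ?thesis .
qed

lemma pt_exhaust:
  obtains x y where "p = pt x y"
proof -
  have ind: "independent {u, v}"
    using orth nonzero v_nonzero
    by (intro pairwise_orthogonal_independent)
      (auto simp: pairwise_def orthogonal_def inner_commute)
  have "u \<noteq> v" using orth nonzero by auto
  then have "card {u, v} = 2" by simp
  then have "span {u, v} = UNIV"
    using ind card_ge_dim_independent[of "{u, v}" UNIV] by simp blast
  then have "p - c \<in> span {u, v}" by simp
  then obtain x y where "p - c - x *\<^sub>R u = y *\<^sub>R v"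
    by (auto simp: span_breakdown_eq span_singleton)
  then show thesis using that[of x y] by (simp add: pt_def algebra_simps)
qed

lemma midpoint_pt: "midpoint (pt a b) (pt x y) = pt ((a + x) / 2) ((b + y) / 2)"
proof -
  have "midpoint (pt a b) (pt x y) = c + ((a + x) / 2) *\<^sub>R u + ((b + y) / 2) *\<^sub>R v"
    unfolding midpoint_def pt_def
    by (simp add: vec_eq_iff field_simps)
  then show ?thesis by (simp add: pt_def)
qed

lemma pt_combination:
  "(1 - t) *\<^sub>R pt a b + t *\<^sub>R pt x y = pt ((1 - t) * a + t * x) ((1 - t) * b + t * y)"
  by (simp add: pt_def algebra_simps)

lemma pt_in_closed_segmentI:
  assumes "0 \<le> t" "t \<le> 1" "p = (1 - t) * a + t * x" "q = (1 - t) * b + t * y"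
  shows "pt p q \<in> closed_segment (pt a b) (pt x y)"
  using assms unfolding in_segment by (auto simp: pt_combination intro!: exI[of _ t])

lemma pt_in_open_segmentI:
  assumes "0 < t" "t < 1" "p = (1 - t) * a + t * x" "q = (1 - t) * b + t * y" "a \<noteq> x \<or> b \<noteq> y"
  shows "pt p q \<in> open_segment (pt a b) (pt x y)"
  using assms unfolding in_segment by (auto simp: pt_combination pt_eq_iff intro!: exI[of _ t])

lemma cross2_pt:
  "cross2 (pt a b - pt x y) (pt a' b' - pt x' y')
     = ((a - x) * (b' - y') - (b - y) * (a' - x')) * cross2 u v"
  unfolding pt_diff by (simp add: cross2_simps cross2_skew[of v u]) (simp add: algebra_simps)

text \<open>Twice the signed area, measured in the frame, of the triangle with the given coordinates. It
  is positive if the triangle runs from \<open>u\<close> towards \<open>v\<close>.\<close>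

definition turn :: "real \<Rightarrow> real \<Rightarrow> real \<Rightarrow> real \<Rightarrow> real \<Rightarrow> real \<Rightarrow> real" where
  "turn x1 x2 y1 y2 z1 z2 = (y1 - x1) * (z2 - x2) - (y2 - x2) * (z1 - x1)"

lemma circumcenter_pt:
  assumes eq1: "(p1 - x1)\<^sup>2 + (p2 - x2)\<^sup>2 = (p1 - y1)\<^sup>2 + (p2 - y2)\<^sup>2"
    and eq2: "(p1 - y1)\<^sup>2 + (p2 - y2)\<^sup>2 = (p1 - z1)\<^sup>2 + (p2 - z2)\<^sup>2"
    and nondeg: "turn x1 x2 y1 y2 z1 z2 \<noteq> 0"
  shows "circumcenter (pt x1 x2) (pt y1 y2) (pt z1 z2) = pt p1 p2"
  unfolding circumcenter_def
proof (rule the_equality)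
  show "dist (pt p1 p2) (pt x1 x2) = dist (pt p1 p2) (pt y1 y2) \<and>
        dist (pt p1 p2) (pt y1 y2) = dist (pt p1 p2) (pt z1 z2)"
    using eq1 eq2 by (simp add: dist_pt_eq_iff)
next
  fix Q assume Q: "dist Q (pt x1 x2) = dist Q (pt y1 y2) \<and> dist Q (pt y1 y2) = dist Q (pt z1 z2)"
  obtain q1 q2 where q: "Q = pt q1 q2" by (rule pt_exhaust)
  have "(q1 - x1)\<^sup>2 + (q2 - x2)\<^sup>2 = (q1 - y1)\<^sup>2 + (q2 - y2)\<^sup>2"
       "(q1 - y1)\<^sup>2 + (q2 - y2)\<^sup>2 = (q1 - z1)\<^sup>2 + (q2 - z2)\<^sup>2"
    using Q by (simp_all add: q dist_pt_eq_iff)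
  \<comment> \<open>The vector from \<open>P\<close> to \<open>Q\<close> is orthogonal to two sides of the triangle.\<close>
  with eq1 eq2 have perp: "(q1 - p1) * (y1 - x1) + (q2 - p2) * (y2 - x2) = 0"
      "(q1 - p1) * (z1 - x1) + (q2 - p2) * (z2 - x2) = 0"
    by (simp_all add: power2_eq_square algebra_simps)
  have "turn x1 x2 y1 y2 z1 z2 * (q1 - p1)
      = (z2 - x2) * ((q1 - p1) * (y1 - x1) + (q2 - p2) * (y2 - x2))
        - (y2 - x2) * ((q1 - p1) * (z1 - x1) + (q2 - p2) * (z2 - x2))"
    "turn x1 x2 y1 y2 z1 z2 * (q2 - p2)
      = (y1 - x1) * ((q1 - p1) * (z1 - x1) + (q2 - p2) * (z2 - x2))
        - (z1 - x1) * ((q1 - p1) * (y1 - x1) + (q2 - p2) * (y2 - x2))"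
    by (simp_all add: turn_def algebra_simps)
  then have "turn x1 x2 y1 y2 z1 z2 * (q1 - p1) = 0" "turn x1 x2 y1 y2 z1 z2 * (q2 - p2) = 0"
    unfolding perp by simp_all
  then show "Q = pt p1 p2"
    using nondeg by (simp add: q)
qed

lemma square_pt_iff:
  "square (pt a1 a2) (pt b1 b2) (pt c1 c2) (pt d1 d2) \<longleftrightarrow>
     (a1 \<noteq> b1 \<or> a2 \<noteq> b2) \<and>
     (a1 - b1)\<^sup>2 + (a2 - b2)\<^sup>2 = (b1 - c1)\<^sup>2 + (b2 - c2)\<^sup>2 \<and>
     (b1 - c1)\<^sup>2 + (b2 - c2)\<^sup>2 = (c1 - d1)\<^sup>2 + (c2 - d2)\<^sup>2 \<and>
     (c1 - d1)\<^sup>2 + (c2 - d2)\<^sup>2 = (d1 - a1)\<^sup>2 + (d2 - a2)\<^sup>2 \<and>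
     (a1 - b1) * (c1 - b1) + (a2 - b2) * (c2 - b2) = 0 \<and>
     (b1 - c1) * (d1 - c1) + (b2 - c2) * (d2 - c2) = 0 \<and>
     (c1 - d1) * (a1 - d1) + (c2 - d2) * (a2 - d2) = 0 \<and>
     (d1 - a1) * (b1 - a1) + (d2 - a2) * (b2 - a2) = 0"
  unfolding square_def dist_pt_eq_iff orthogonal_pt_iff by (auto simp: pt_eq_iff)

lemma pt_in_line_iff:
  assumes "x1 \<noteq> y1 \<or> x2 \<noteq> y2"
  shows "pt z1 z2 \<in> affine hull {pt x1 x2, pt y1 y2} \<longleftrightarrow> turn x1 x2 y1 y2 z1 z2 = 0"
proof
  assume "pt z1 z2 \<in> affine hull {pt x1 x2, pt y1 y2}"
  then obtain a b where ab: "a + b = 1" "pt z1 z2 = a *\<^sub>R pt x1 x2 + b *\<^sub>R pt y1 y2"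
    unfolding affine_hull_2 by blast
  then have "a = 1 - b" by simp
  then have "z1 = (1 - b) * x1 + b * y1" "z2 = (1 - b) * x2 + b * y2"
    using ab(2) by (simp_all add: pt_combination pt_eq_iff)
  then show "turn x1 x2 y1 y2 z1 z2 = 0"
    unfolding turn_def by algebra
next
  assume 0: "turn x1 x2 y1 y2 z1 z2 = 0"
  \<comment> \<open>The parameter of the foot of the perpendicular onto the line.\<close>
  define n where "n = (y1 - x1)\<^sup>2 + (y2 - x2)\<^sup>2"
  have "n \<noteq> 0"
    using assms by (auto simp: n_def sum_power2_eq_zero_iff)
  define t where "t = ((z1 - x1) * (y1 - x1) + (z2 - x2) * (y2 - x2)) / n"
  have tn: "t * n = (z1 - x1) * (y1 - x1) + (z2 - x2) * (y2 - x2)"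
    using \<open>n \<noteq> 0\<close> by (simp add: t_def)
  have "n * (x1 + t * (y1 - x1) - z1) = 0" "n * (x2 + t * (y2 - x2) - z2) = 0"
    using 0 tn unfolding n_def turn_def by algebra+
  then have "x1 + t * (y1 - x1) - z1 = 0" "x2 + t * (y2 - x2) - z2 = 0"
    using \<open>n \<noteq> 0\<close> by (simp_all only: mult_eq_0_iff simp_thms)
  then have "z1 = (1 - t) * x1 + t * y1" "z2 = (1 - t) * x2 + t * y2"
    by (simp_all add: algebra_simps)
  then have "pt z1 z2 = (1 - t) *\<^sub>R pt x1 x2 + t *\<^sub>R pt y1 y2"
    by (simp add: pt_combination)
  then show "pt z1 z2 \<in> affine hull {pt x1 x2, pt y1 y2}"
    unfolding affine_hull_2 by force
qed

text \<open>\<open>turn\<close> is affine in its last point and vanishes on the line, so the segment from \<open>P\<close> to \<open>Z\<close>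
  avoids the line exactly if \<open>turn\<close> has the same strict sign at both ends.\<close>

lemma same_side_pt_iff:
  assumes "x1 \<noteq> y1 \<or> x2 \<noteq> y2" and z: "turn x1 x2 y1 y2 z1 z2 > 0"
  shows "same_side (pt x1 x2) (pt y1 y2) (pt p1 p2) (pt z1 z2) \<longleftrightarrow> turn x1 x2 y1 y2 p1 p2 > 0"
proof -
  define f where "f = turn x1 x2 y1 y2"
  have f_comb: "f ((1 - t) * p1 + t * z1) ((1 - t) * p2 + t * z2)
      = (1 - t) * f p1 p2 + t * f z1 z2" for t
    by (simp add: f_def turn_def algebra_simps)
  have "same_side (pt x1 x2) (pt y1 y2) (pt p1 p2) (pt z1 z2)
      \<longleftrightarrow> (\<forall>t. 0 \<le> t \<and> t \<le> 1 \<longrightarrow> (1 - t) * f p1 p2 + t * f z1 z2 \<noteq> 0)"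
    unfolding same_side_def disjoint_iff in_segment
    by (auto simp: pt_combination pt_in_line_iff[OF assms(1)] f_comb simp flip: f_def)
  also have "\<dots> \<longleftrightarrow> f p1 p2 > 0"
  proof
    assume *: "\<forall>t. 0 \<le> t \<and> t \<le> 1 \<longrightarrow> (1 - t) * f p1 p2 + t * f z1 z2 \<noteq> 0"
    show "f p1 p2 > 0"
    proof (rule ccontr)
      assume "\<not> f p1 p2 > 0"
      then have le: "f p1 p2 \<le> 0" and pos: "f z1 z2 - f p1 p2 > 0"
        using z by (simp_all add: f_def)
      \<comment> \<open>The zero of the affine function on the segment.\<close>
      define t where "t = - f p1 p2 / (f z1 z2 - f p1 p2)"
      have "t * (f z1 z2 - f p1 p2) = - f p1 p2"
        using pos by (simp add: t_def)
      then have "(1 - t) * f p1 p2 + t * f z1 z2 = 0"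
        by (simp add: algebra_simps)
      moreover have "0 \<le> t" "t \<le> 1"
        using le pos z by (auto simp: t_def f_def field_simps)
      ultimately show False using * by blast
    qed
  next
    assume p: "f p1 p2 > 0"
    show "\<forall>t. 0 \<le> t \<and> t \<le> 1 \<longrightarrow> (1 - t) * f p1 p2 + t * f z1 z2 \<noteq> 0"
    proof (intro allI impI)
      fix t :: real assume t: "0 \<le> t \<and> t \<le> 1"
      have "(1 - t) * f p1 p2 + t * f z1 z2 > 0"
      proof (cases "t = 0")
        case False
        then have "t * f z1 z2 > 0" using t z by (simp add: f_def)
        moreover have "(1 - t) * f p1 p2 \<ge> 0" using t p by simp
        ultimately show ?thesis by linarith
      qed (simp add: p)
      then show "(1 - t) * f p1 p2 + t * f z1 z2 \<noteq> 0" by simp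
    qed
  qed
  finally show ?thesis by (simp add: f_def)
qed

text \<open>In a positively oriented triangle the inward square arises from the side \<open>X Y\<close> by a positive
  quarter turn. The other square on the side is excluded by the sign of \<open>turn\<close>, which makes the
  center unique.\<close>

lemma inward_square_center_pt:
  assumes z: "turn x1 x2 y1 y2 z1 z2 > 0"
  shows "inward_square_center (pt x1 x2) (pt y1 y2) (pt z1 z2)
       = pt ((x1 + y1) / 2 - (y2 - x2) / 2) ((x2 + y2) / 2 + (y1 - x1) / 2)"
proof -
  have ne: "x1 \<noteq> y1 \<or> x2 \<noteq> y2"
    using z by (auto simp: turn_def)
  note side = same_side_pt_iff[OF ne z]
  define d1 d2 where "d1 = y1 - x1" and "d2 = y2 - x2"
  have n: "d1\<^sup>2 + d2\<^sup>2 > 0"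
    using ne by (auto simp: d1_def d2_def sum_power2_gt_zero_iff)
  show ?thesis
    unfolding inward_square_center_def
  proof (rule the_equality)
    have "square (pt x1 x2) (pt y1 y2) (pt (y1 - d2) (y2 + d1)) (pt (x1 - d2) (x2 + d1))"
      using ne by (simp add: square_pt_iff d1_def d2_def power2_eq_square algebra_simps)
    moreover have "turn x1 x2 y1 y2 (y1 - d2) (y2 + d1) = d1\<^sup>2 + d2\<^sup>2"
      by (simp add: turn_def d1_def d2_def power2_eq_square algebra_simps)
    then have "same_side (pt x1 x2) (pt y1 y2) (pt (y1 - d2) (y2 + d1)) (pt z1 z2)"
      using n by (simp add: side)
    moreover have "pt ((x1 + y1) / 2 - (y2 - x2) / 2) ((x2 + y2) / 2 + (y1 - x1) / 2)
        = midpoint (pt x1 x2) (pt (y1 - d2) (y2 + d1))"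
      by (simp add: midpoint_pt pt_eq_iff d1_def d2_def field_simps)
    ultimately show "\<exists>P Q. square (pt x1 x2) (pt y1 y2) P Q \<and>
        same_side (pt x1 x2) (pt y1 y2) P (pt z1 z2) \<and>
        pt ((x1 + y1) / 2 - (y2 - x2) / 2) ((x2 + y2) / 2 + (y1 - x1) / 2)
          = midpoint (pt x1 x2) P"
      by blast
  next
    fix M
    assume "\<exists>P Q. square (pt x1 x2) (pt y1 y2) P Q \<and>
        same_side (pt x1 x2) (pt y1 y2) P (pt z1 z2) \<and> M = midpoint (pt x1 x2) P"
    then obtain P Q where PQ: "square (pt x1 x2) (pt y1 y2) P Q"
        "same_side (pt x1 x2) (pt y1 y2) P (pt z1 z2)" "M = midpoint (pt x1 x2) P"
      by blast
    obtain p1 p2 where P: "P = pt p1 p2" by (rule pt_exhaust)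
    obtain q1 q2 where Q: "Q = pt q1 q2" by (rule pt_exhaust)
    define r1 r2 where "r1 = p1 - y1" and "r2 = p2 - y2"
    have orth: "d1 * r1 + d2 * r2 = 0" and len: "d1\<^sup>2 + d2\<^sup>2 = r1\<^sup>2 + r2\<^sup>2"
      using PQ(1) unfolding P Q square_pt_iff d1_def d2_def r1_def r2_def
      by (auto simp: power2_eq_square algebra_simps)
    have pos: "d1 * r2 - d2 * r1 > 0"
      using PQ(2) unfolding P side by (simp add: turn_def d1_def d2_def r1_def r2_def algebra_simps)
    \<comment> \<open>Lagrange's identity for two orthogonal vectors of equal length.\<close>
    have "(d1 * r2 - d2 * r1)\<^sup>2 = (d1\<^sup>2 + d2\<^sup>2)\<^sup>2"
      using orth len by algebra
    then have D: "d1 * r2 - d2 * r1 = d1\<^sup>2 + d2\<^sup>2"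
      using pos n by (auto simp: power2_eq_iff)
    have "(d1\<^sup>2 + d2\<^sup>2) * (r1 + d2) = 0" "(d1\<^sup>2 + d2\<^sup>2) * (r2 - d1) = 0"
      using orth D by algebra+
    then have "r1 = - d2" "r2 = d1" using n by auto
    then have "p1 = y1 - d2" "p2 = y2 + d1" by (simp_all add: r1_def r2_def)
    then show "M = pt ((x1 + y1) / 2 - (y2 - x2) / 2) ((x2 + y2) / 2 + (y1 - x1) / 2)"
      by (simp add: PQ(3) P midpoint_pt pt_eq_iff d1_def d2_def field_simps)
  qed
qed

section \<open>The Steiner point of the kite\<close>

lemma circle_through_pt_iff:
  assumes "(p1 - x1)\<^sup>2 + (p2 - x2)\<^sup>2 = (p1 - y1)\<^sup>2 + (p2 - y2)\<^sup>2"
    and "(p1 - y1)\<^sup>2 + (p2 - y2)\<^sup>2 = (p1 - z1)\<^sup>2 + (p2 - z2)\<^sup>2"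
    and "turn x1 x2 y1 y2 z1 z2 \<noteq> 0"
  shows "pt q1 q2 \<in> circle_through (pt x1 x2) (pt y1 y2) (pt z1 z2)
    \<longleftrightarrow> (p1 - q1)\<^sup>2 + (p2 - q2)\<^sup>2 = (p1 - x1)\<^sup>2 + (p2 - x2)\<^sup>2"
  unfolding circle_through_def circumcenter_pt[OF assms] by (simp add: dist_pt_eq_iff)

text \<open>With the sign \<open>s\<close> one computation serves both \<open>A\<close> (\<open>s = 1\<close>) and \<open>C\<close> (\<open>s = -1\<close>): the half
  turn of the frame exchanges the roles of \<open>A\<close> and \<open>C\<close> and of \<open>B\<close> and \<open>D\<close>, with \<open>- e\<close> in place of
  \<open>e\<close>. The center of the circle is \<open>(s (1/2 - e\<^sup>2/4), e/2)\<close>.\<close>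

lemma midray_circle_side_vertex:
  assumes s: "s = 1 \<or> s = -1"
  shows "pt x y \<in> midray_circle (pt s 0) (pt 0 (e + s)) (pt (-s) 0) (pt 0 (e - s))
    \<longleftrightarrow> x\<^sup>2 + y\<^sup>2 - s * (1 - e\<^sup>2 / 2) * x - e * y = 0"
proof -
  have "pt x y \<in> circle_through (pt (s / 2) ((e + s) / 2)) (pt 0 0) (pt (s / 2) ((e - s) / 2))
    \<longleftrightarrow> (s * (1 / 2 - e\<^sup>2 / 4) - x)\<^sup>2 + (e / 2 - y)\<^sup>2
       = (s * (1 / 2 - e\<^sup>2 / 4) - s / 2)\<^sup>2 + (e / 2 - (e + s) / 2)\<^sup>2"
    using s by (intro circle_through_pt_iff)
      (auto simp: turn_def power2_eq_square field_simps)
  then show ?thesis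
    using s unfolding midray_circle_def midpoint_pt
    by (auto simp: power2_eq_square field_simps)
qed

text \<open>Likewise for \<open>B\<close> (\<open>s = 1\<close>) and \<open>D\<close> (\<open>s = -1\<close>). The circle contains \<open>(0, e)\<close>, the midpoint of
  \<open>B D\<close>, which is why \<open>y - e\<close> splits off in its equation.\<close>

lemma midray_circle_axis_vertex:
  assumes s: "s = 1 \<or> s = -1" and e: "-1 < e" "e < 1"
  shows "pt x y \<in> midray_circle (pt 0 (e + s)) (pt (-s) 0) (pt 0 (e - s)) (pt s 0)
    \<longleftrightarrow> 2 * (1 - s * e) * x\<^sup>2 + (y - e) * (2 * (1 - s * e) * y + s * (e\<^sup>2 - 2)) = 0"
proof -
  have se: "1 - s * e > 0" using s e by auto
  \<comment> \<open>The center is \<open>(0, k)\<close>; \<open>k\<close> solves the linear equation that puts it at equal distance from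
    \<open>(0, e)\<close> and from the midpoint of a side.\<close>
  define k where "k = s * (2 + 2 * s * e - 3 * e\<^sup>2) / (4 * (1 - s * e))"
  have k: "k * (4 * (1 - s * e)) = s * (2 + 2 * s * e - 3 * e\<^sup>2)"
    using se by (simp add: k_def)
  have ss: "s * s = 1" using s by auto
  have "pt x y \<in> circle_through (pt (-s / 2) ((e + s) / 2)) (pt 0 e) (pt (s / 2) ((e + s) / 2))
    \<longleftrightarrow> (0 - x)\<^sup>2 + (k - y)\<^sup>2 = (0 - (-s / 2))\<^sup>2 + (k - (e + s) / 2)\<^sup>2"
  proof (rule circle_through_pt_iff)
    show 1: "(0 - (-s / 2))\<^sup>2 + (k - (e + s) / 2)\<^sup>2 = (0 - 0)\<^sup>2 + (k - e)\<^sup>2"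
      using k s by (auto simp: power2_eq_square field_simps)
    show "(0 - 0)\<^sup>2 + (k - e)\<^sup>2 = (0 - s / 2)\<^sup>2 + (k - (e + s) / 2)\<^sup>2"
      using 1 by simp
    show "turn (-s / 2) ((e + s) / 2) 0 e (s / 2) ((e + s) / 2) \<noteq> 0"
      using s e by (auto simp: turn_def field_simps)
  qed
  also have "\<dots> \<longleftrightarrow> x\<^sup>2 + (y - e) * (y + e - 2 * k) = 0"
    using k s by (auto simp: power2_eq_square field_simps)
  also have "\<dots> \<longleftrightarrow> (2 * (1 - s * e)) * (x\<^sup>2 + (y - e) * (y + e - 2 * k)) = 0"
    using se by simp
  also have "(2 * (1 - s * e)) * (x\<^sup>2 + (y - e) * (y + e - 2 * k))
      = 2 * (1 - s * e) * x\<^sup>2 + (y - e) * (2 * (1 - s * e) * y + s * (e\<^sup>2 - 2))"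
    using k ss by algebra
  finally show ?thesis
    unfolding midray_circle_def midpoint_pt by simp
qed

text \<open>The circles of \<open>A\<close> and \<open>C\<close> meet only at \<open>(0, 0)\<close> and \<open>(0, e)\<close>. The former is not on the circle
  of \<open>B\<close>, since for \<open>e \<noteq> 0\<close> that would force \<open>e\<^sup>2 = 2\<close>.\<close>

lemma steiner_point_kite:
  assumes e: "-1 < e" "e < 1" "e \<noteq> 0"
  shows "steiner_point (pt 1 0) (pt 0 (e + 1)) (pt (-1) 0) (pt 0 (e - 1)) = pt 0 e"
proof -
  note side = midray_circle_side_vertex[of 1 _ _ e] midray_circle_side_vertex[of "-1" _ _ e]
  note axis = midray_circle_axis_vertex[of 1 e] midray_circle_axis_vertex[of "-1" e]
  have e2: "e\<^sup>2 < 1" using e by (simp add: abs_square_less_1)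
  show ?thesis
    unfolding steiner_point_def
  proof (rule the_equality)
    show "pt 0 e \<in> midray_circle (pt 1 0) (pt 0 (e + 1)) (pt (-1) 0) (pt 0 (e - 1)) \<inter>
        midray_circle (pt 0 (e + 1)) (pt (-1) 0) (pt 0 (e - 1)) (pt 1 0) \<inter>
        midray_circle (pt (-1) 0) (pt 0 (e - 1)) (pt 1 0) (pt 0 (e + 1)) \<inter>
        midray_circle (pt 0 (e - 1)) (pt 1 0) (pt 0 (e + 1)) (pt (-1) 0)"
      using side axis e by (simp add: power2_eq_square)
  next
    fix Q
    assume Q: "Q \<in> midray_circle (pt 1 0) (pt 0 (e + 1)) (pt (-1) 0) (pt 0 (e - 1)) \<inter>
        midray_circle (pt 0 (e + 1)) (pt (-1) 0) (pt 0 (e - 1)) (pt 1 0) \<inter>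
        midray_circle (pt (-1) 0) (pt 0 (e - 1)) (pt 1 0) (pt 0 (e + 1)) \<inter>
        midray_circle (pt 0 (e - 1)) (pt 1 0) (pt 0 (e + 1)) (pt (-1) 0)"
    obtain x y where q: "Q = pt x y" by (rule pt_exhaust)
    have a: "x\<^sup>2 + y\<^sup>2 - (1 - e\<^sup>2 / 2) * x - e * y = 0"
      and c: "x\<^sup>2 + y\<^sup>2 - (e\<^sup>2 / 2 - 1) * x - e * y = 0"
      and b: "2 * (1 - e) * x\<^sup>2 + (y - e) * (2 * (1 - e) * y + (e\<^sup>2 - 2)) = 0"
      using Q side axis e unfolding q by simp_all
    have "(1 - e\<^sup>2 / 2) * x = 0" using a c by algebra
    with e2 have x: "x = 0" by simp
    with a have "y * (y - e) = 0" by (simp add: power2_eq_square algebra_simps)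
    then consider "y = 0" | "y = e" by auto
    then show "Q = pt 0 e"
    proof cases
      case 1
      with b x e have "e\<^sup>2 = 2" by simp
      with e2 show ?thesis by simp
    qed (simp add: q x)
  qed
qed

section \<open>The four circumcenters\<close>

lemma X642_pt:
  assumes t: "turn x1 x2 y1 y2 z1 z2 > 0"
    and "a1 = (y1 + z1) / 2 - (z2 - y2) / 2" "a2 = (y2 + z2) / 2 + (z1 - y1) / 2"
    and "b1 = (z1 + x1) / 2 - (x2 - z2) / 2" "b2 = (z2 + x2) / 2 + (x1 - z1) / 2"
    and "c1 = (x1 + y1) / 2 - (y2 - x2) / 2" "c2 = (x2 + y2) / 2 + (y1 - x1) / 2"
    and "(p1 - a1)\<^sup>2 + (p2 - a2)\<^sup>2 = (p1 - b1)\<^sup>2 + (p2 - b2)\<^sup>2"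
    and "(p1 - b1)\<^sup>2 + (p2 - b2)\<^sup>2 = (p1 - c1)\<^sup>2 + (p2 - c2)\<^sup>2"
    and "turn a1 a2 b1 b2 c1 c2 \<noteq> 0"
  shows "X642 (pt x1 x2) (pt y1 y2) (pt z1 z2) = pt p1 p2"
proof -
  have cyc: "turn y1 y2 z1 z2 x1 x2 > 0" "turn z1 z2 x1 x2 y1 y2 > 0"
    using t by (simp_all add: turn_def algebra_simps)
  show ?thesis
    unfolding X642_def inward_square_center_pt[OF t] inward_square_center_pt[OF cyc(1)]
      inward_square_center_pt[OF cyc(2)] assms(2-7)[symmetric]
    by (rule circumcenter_pt[OF assms(8-10)])
qed

text \<open>The sign \<open>s\<close> plays the same role as for the midray circles: \<open>s = 1\<close> gives the triangles \<open>E A B\<close> and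
  \<open>E B C\<close>, and \<open>s = -1\<close> gives \<open>E C D\<close> and \<open>E D A\<close>. The product \<open>e (e + s)\<close> is, up to a constant
  factor, the area of the triangle of the square centers.\<close>

lemma X642_kite:
  assumes s: "s = 1 \<or> s = -1" and e: "e \<noteq> 0" "-1 < e" "e < 1"
  shows "X642 (pt 0 e) (pt s 0) (pt 0 (e + s)) = pt (s / 4) (e / 2 + s / 4)"
    and "X642 (pt 0 e) (pt 0 (e + s)) (pt (-s) 0) = pt (-s / 4) (e / 2 + s / 4)"
proof -
  have ne: "e * (e + s) \<noteq> 0" using s e by auto
  show "X642 (pt 0 e) (pt s 0) (pt 0 (e + s)) = pt (s / 4) (e / 2 + s / 4)"
    by (rule X642_pt[OF _ refl refl refl refl refl refl])
      (use s ne in \<open>auto simp: turn_def power2_eq_square field_simps\<close>)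
  show "X642 (pt 0 e) (pt 0 (e + s)) (pt (-s) 0) = pt (-s / 4) (e / 2 + s / 4)"
    by (rule X642_pt[OF _ refl refl refl refl refl refl])
      (use s ne in \<open>auto simp: turn_def power2_eq_square field_simps\<close>)
qed

section \<open>Squares with sides parallel to the axes, and the kite\<close>

lemma quad_area_pt:
  assumes "a1 \<noteq> c1 \<or> a2 \<noteq> c2"
    and "pt x y \<in> closed_segment (pt a1 a2) (pt c1 c2)"
    and "pt x y \<in> open_segment (pt b1 b2) (pt d1 d2)"
  shows "quad_area (pt a1 a2) (pt b1 b2) (pt c1 c2) (pt d1 d2)
       = \<bar>(c1 - a1) * (d2 - b2) - (c2 - a2) * (d1 - b1)\<bar> * \<bar>cross2 u v\<bar> / 2"
proof -
  have "pt a1 a2 \<noteq> pt c1 c2" using assms(1) by (simp add: pt_eq_iff)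
  from quad_area_diagonals[OF this assms(2,3)] show ?thesis
    by (simp add: cross2_pt abs_mult)
qed

context
  fixes n r :: real
  assumes r: "r \<noteq> 0"
begin

lemma square_centered:
  "square (pt r (n + r)) (pt (-r) (n + r)) (pt (-r) (n - r)) (pt r (n - r))"
  using r by (simp add: square_pt_iff)

lemma center_in_diagonals:
  "pt 0 n \<in> open_segment (pt r (n + r)) (pt (-r) (n - r))"
  "pt 0 n \<in> open_segment (pt (-r) (n + r)) (pt r (n - r))"
  using r by (auto simp: field_simps intro!: pt_in_open_segmentI[of "1/2"])

lemma diagonal_point_centered:
  "diagonal_point (pt r (n + r)) (pt (-r) (n + r)) (pt (-r) (n - r)) (pt r (n - r)) = pt 0 n"
proof -
  have "closed_segment (pt r (n + r)) (pt (-r) (n - r)) \<inter>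
      closed_segment (pt (-r) (n + r)) (pt r (n - r)) = {pt 0 n}"
  proof (intro subset_antisym subsetI)
    fix p
    assume "p \<in> closed_segment (pt r (n + r)) (pt (-r) (n - r)) \<inter>
      closed_segment (pt (-r) (n + r)) (pt r (n - r))"
    then obtain s t where st: "p = pt ((1 - s) * r + s * (-r)) ((1 - s) * (n + r) + s * (n - r))"
        "p = pt ((1 - t) * (-r) + t * r) ((1 - t) * (n + r) + t * (n - r))"
      unfolding Int_iff in_segment pt_combination by blast
    then have "(1 - s) * r + s * (-r) = (1 - t) * (-r) + t * r"
        "(1 - s) * (n + r) + s * (n - r) = (1 - t) * (n + r) + t * (n - r)"
      by (simp_all only: pt_eq_iff)
    then have "r * (1 - s - t) = 0" "r * (s - t) = 0"
      by algebra+
    then have "s = 1 / 2" using r by simp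
    then show "p \<in> {pt 0 n}" by (simp add: st(1) field_simps)
  next
    fix p assume "p \<in> {pt 0 n}"
    then show "p \<in> closed_segment (pt r (n + r)) (pt (-r) (n - r)) \<inter>
      closed_segment (pt (-r) (n + r)) (pt r (n - r))"
      using center_in_diagonals by (simp add: open_segment_def)
  qed
  then show ?thesis
    unfolding diagonal_point_def by simp
qed

lemma quad_area_centered:
  "quad_area (pt r (n + r)) (pt (-r) (n + r)) (pt (-r) (n - r)) (pt r (n - r))
     = 4 * r\<^sup>2 * \<bar>cross2 u v\<bar>"
proof -
  have "quad_area (pt r (n + r)) (pt (-r) (n + r)) (pt (-r) (n - r)) (pt r (n - r))
      = \<bar>(-r - r) * ((n - r) - (n + r)) - ((n - r) - (n + r)) * (r - (-r))\<bar> * \<bar>cross2 u v\<bar> / 2"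
    using r center_in_diagonals by (intro quad_area_pt) (auto simp: open_segment_def)
  also have "(-r - r) * ((n - r) - (n + r)) - ((n - r) - (n + r)) * (r - (-r)) = 8 * r\<^sup>2"
    by (simp add: power2_eq_square algebra_simps)
  finally show ?thesis by simp
qed

end

lemma quad_area_kite:
  assumes "-1 < e" "e < 1"
  shows "quad_area (pt 1 0) (pt 0 (e + 1)) (pt (-1) 0) (pt 0 (e - 1)) = 2 * \<bar>cross2 u v\<bar>"
proof -
  have "pt 0 0 \<in> closed_segment (pt 1 0) (pt (-1) 0)"
    by (rule pt_in_closed_segmentI[of "1/2"]) simp_all
  moreover have "pt 0 0 \<in> open_segment (pt 0 (e + 1)) (pt 0 (e - 1))"
    using assms by (intro pt_in_open_segmentI[of "(e + 1) / 2"]) (simp_all add: field_simps)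
  ultimately show ?thesis
    by (subst quad_area_pt) auto
qed

lemma homothetic_centered:
  assumes "r \<noteq> 0" "r' \<noteq> 0"
  shows "homothetic_quads
    (pt r (n + r)) (pt (-r) (n + r)) (pt (-r) (n - r)) (pt r (n - r))
    (pt r' (n + r')) (pt (-r') (n + r')) (pt (-r') (n - r')) (pt r' (n - r'))"
proof -
  have hom: "pt 0 n + k *\<^sub>R (pt x y - pt 0 n) = pt (k * x) (n + k * (y - n))" for k x y
    by (simp add: pt_def algebra_simps)
  show ?thesis
    unfolding homothetic_quads_def
    by (rule exI[of _ "pt 0 n"], rule exI[of _ "r' / r"]) (use assms in \<open>simp add: hom pt_eq_iff\<close>)
qed

end

section \<open>A frame for every equidiagonal kite\<close>

text \<open>\<open>B\<close> and \<open>D\<close> are equidistant from \<open>A\<close> and \<open>C\<close>, hence on the perpendicular bisector of \<open>A C\<close>. So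
  the diagonals can cross only at the midpoint of \<open>A C\<close>, which makes the ordinates of \<open>B\<close> and \<open>D\<close>
  differ in sign; equality of the diagonals makes them differ by 2.\<close>

lemma kite_frame:
  assumes "convex_quadrilateral A B C D" "equidiagonal A B C D"
    and "dist A B = dist B C" "dist A D = dist C D"
  obtains c u v e where "square_frame u v" "-1 < e" "e < 1"
    "A = square_frame.pt c u v 1 0" "B = square_frame.pt c u v 0 (e + 1)"
    "C = square_frame.pt c u v (-1) 0" "D = square_frame.pt c u v 0 (e - 1)"
proof -
  define c where "c = midpoint A C"
  define u where "u = A - c"
  define w :: point where "w = (\<chi> i. if i = 1 then - (u$2) else u$1)"
  have A: "A = c + u" and C: "C = c - u"
    by (simp_all add: u_def c_def midpoint_def vec_eq_iff field_simps)
  have "\<not> collinear {A, B, C}"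
    using assms(1) by (simp add: convex_quadrilateral_def)
  then have "A \<noteq> C" by (auto simp: insert_commute)
  then have u: "u \<noteq> 0" using A C by auto
  have uw: "u \<bullet> w = 0"
    by (simp add: w_def inner_vec_def sum_2)
  have nw: "norm w = norm u"
    unfolding norm_eq_sqrt_inner by (simp add: w_def inner_vec_def sum_2)
  have on_axis: "\<exists>b. X = c + b *\<^sub>R w" if "dist X A = dist X C" for X
  proof -
    define q where "q = X - c"
    have "norm (q - u) = norm (q + u)"
      using that by (simp add: dist_norm A C q_def algebra_simps)
    then have "(q - u) \<bullet> (q - u) = (q + u) \<bullet> (q + u)"
      by (simp add: norm_eq_sqrt_inner)
    then have "q \<bullet> u = 0"
      by (simp add: inner_diff inner_add inner_commute algebra_simps)
    then have 0: "q$1 * u$1 + q$2 * u$2 = 0"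
      by (simp add: inner_vec_def sum_2)
    have n: "(u$1)\<^sup>2 + (u$2)\<^sup>2 \<noteq> 0"
      using u by (auto simp: sum_power2_eq_zero_iff vec_eq_iff forall_2)
    define b where "b = (q$2 * u$1 - q$1 * u$2) / ((u$1)\<^sup>2 + (u$2)\<^sup>2)"
    have b: "b * ((u$1)\<^sup>2 + (u$2)\<^sup>2) = q$2 * u$1 - q$1 * u$2"
      using n by (simp add: b_def)
    have "((u$1)\<^sup>2 + (u$2)\<^sup>2) * (q$1 + b * u$2) = 0" "((u$1)\<^sup>2 + (u$2)\<^sup>2) * (q$2 - b * u$1) = 0"
      using b 0 by algebra+
    then have "q$1 + b * u$2 = 0" "q$2 - b * u$1 = 0"
      using n by (simp_all only: mult_eq_0_iff simp_thms)
    then have "q = b *\<^sub>R w"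
      by (simp add: w_def vec_eq_iff forall_2)
    then show ?thesis
      by (auto simp: q_def algebra_simps)
  qed
  obtain b where B: "B = c + b *\<^sub>R w"
    using on_axis[of B] assms(3) by (auto simp: dist_commute)
  obtain d where D: "D = c + d *\<^sub>R w"
    using on_axis[of D] assms(4) by (auto simp: dist_commute)
  \<comment> \<open>The crossing point lies on both axes, hence is \<open>c\<close>, and it is strictly between \<open>B\<close> and \<open>D\<close>.\<close>
  obtain X where X: "X \<in> open_segment A C" "X \<in> open_segment B D"
    using assms(1) by (auto simp: convex_quadrilateral_def)
  obtain s where s: "X = (1 - s) *\<^sub>R A + s *\<^sub>R C"
    using X(1) by (auto simp: in_segment)
  obtain t where t: "0 < t" "t < 1" "X = (1 - t) *\<^sub>R B + t *\<^sub>R D" "B \<noteq> D"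
    using X(2) by (auto simp: in_segment)
  have "((1 - t) * b + t * d) *\<^sub>R w = X - c"
    by (simp add: t(3) B D algebra_simps)
  also have "\<dots> = (1 - 2 * s) *\<^sub>R u"
    by (simp add: s A C algebra_simps scaleR_2 flip: scaleR_scaleR)
  finally have "((1 - t) * b + t * d) * (w \<bullet> w) = 0"
    using uw by (metis inner_scaleR_left mult_zero_right)
  then have between: "(1 - t) * b + t * d = 0"
    using u nw by auto
  have "norm (A - C) = norm (B - D)"
    using assms(2) by (simp add: equidiagonal_def dist_norm)
  moreover have "A - C = 2 *\<^sub>R u" "B - D = (b - d) *\<^sub>R w"
    by (simp_all add: A B C D algebra_simps scaleR_2)
  ultimately have "2 * norm u = \<bar>b - d\<bar> * norm u"
    by (simp add: nw)
  then have bd: "\<bar>b - d\<bar> = 2"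
    using u by simp
  \<comment> \<open>The second basis vector is \<open>w\<close> or \<open>- w\<close>, so that \<open>B\<close> is on its positive side.\<close>
  define \<sigma> :: real where "\<sigma> = (if b > d then 1 else -1)"
  define e where "e = \<sigma> * b - 1"
  have \<sigma>: "\<sigma> * \<sigma> = 1" by (simp add: \<sigma>_def)
  have b: "\<sigma> * b = e + 1" by (simp add: e_def)
  have d: "\<sigma> * d = e - 1"
    using bd by (auto simp: \<sigma>_def e_def split: if_splits)
  have "(1 - t) * (\<sigma> * b) + t * (\<sigma> * d) = \<sigma> * ((1 - t) * b + t * d)"
    by (simp add: algebra_simps)
  with between have "(1 - t) * (e + 1) + t * (e - 1) = 0"
    by (simp add: b d)
  then have "e = 2 * t - 1" by (simp add: algebra_simps)
  then have e: "-1 < e" "e < 1" using t by simp_all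
  interpret square_frame c u "\<sigma> *\<^sub>R w"
    using u uw nw by unfold_locales (auto simp: \<sigma>_def)
  have "A = pt 1 0" "C = pt (-1) 0"
    by (simp_all add: pt_def A C)
  moreover have "B = pt 0 (e + 1)" "D = pt 0 (e - 1)"
    unfolding pt_def B D b[symmetric] d[symmetric]
    by (simp_all add: \<sigma> mult.commute mult.left_commute)
  ultimately show thesis
    using that[OF square_frame_axioms e] by simp
qed

theorem theorem10p7:
  fixes A B C D E F G H I P Q R S :: point
  assumes "convex_quadrilateral A B C D"
    and "equidiagonal A B C D"
    and "dist A B = dist B C" and "dist A D = dist C D"
    and "\<not> square A B C D"
    and "E = steiner_point A B C D"
    and "F = X642 E A B" and "G = X642 E B C" and "H = X642 E C D" and "I = X642 E D A"
    and varignon: "P = midpoint A B" "Q = midpoint B C" "R = midpoint C D" "S = midpoint D A"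
  shows "square F G H I \<and> square P Q R S \<and>
         homothetic_quads F G H I P Q R S \<and>
         quad_area A B C D = 8 * quad_area F G H I \<and>
         diagonal_point F G H I = diagonal_point P Q R S"
proof -
  obtain c u v e where fr: "square_frame u v" and e: "-1 < e" "e < 1"
    and V: "A = square_frame.pt c u v 1 0" "B = square_frame.pt c u v 0 (e + 1)"
    "C = square_frame.pt c u v (-1) 0" "D = square_frame.pt c u v 0 (e - 1)"
    by (rule kite_frame[OF assms(1-4)])
  interpret square_frame c u v by (rule fr)
  have e0: "e \<noteq> 0"
    using assms(5) by (auto simp: V square_pt_iff)
  have E: "E = pt 0 e"
    using assms(6) steiner_point_kite[OF e e0] by (simp add: V)
  note X1 = X642_kite[of 1 e, OF _ e0 e] and X2 = X642_kite[of "-1" e, OF _ e0 e]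
  have F: "F = pt (1/4) (e/2 + 1/4)" and G: "G = pt (-(1/4)) (e/2 + 1/4)"
    and H: "H = pt (-(1/4)) (e/2 - 1/4)" and I: "I = pt (1/4) (e/2 - 1/4)"
    using assms(7-10) X1 X2 by (simp_all add: V E)
  have P: "P = pt (1/2) (e/2 + 1/2)" and Q: "Q = pt (-(1/2)) (e/2 + 1/2)"
    and R: "R = pt (-(1/2)) (e/2 - 1/2)" and S: "S = pt (1/2) (e/2 - 1/2)"
    using varignon by (simp_all add: V midpoint_pt add_divide_distrib diff_divide_distrib)
  have "quad_area A B C D = 8 * quad_area F G H I"
    unfolding V F G H I quad_area_kite[OF e] by (subst quad_area_centered) (auto simp: power2_eq_square)
  moreover have "square F G H I" "square P Q R S"
    unfolding F G H I P Q R S by (rule square_centered, simp)+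
  moreover have "homothetic_quads F G H I P Q R S"
    unfolding F G H I P Q R S by (rule homothetic_centered) simp_all
  moreover have "diagonal_point F G H I = diagonal_point P Q R S"
    unfolding F G H I P Q R S by (subst (1 2) diagonal_point_centered) simp_all
  ultimately show ?thesis by blast
qed

end
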